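(* For every $p,k\in\mathbb{N}$ and every choice of labels $u_1,\ldots,u_p$, there is a bijection between $\mathcal{NC}(W^k)$ and $\mathcal{NC}^2(\widetilde W^k)$.
   Context: Fix $p,k\in\mathbb{N}$ and labels $u_1,\ldots,u_p$ (elements of some set, not necessarily distinct). **The set $\mathcal{NC}(W^k)$.** Let $W=12\ldots p\,p^*\ldots2^*1^*$, a word of length $2p$; $W^k$ is its $k$-th power. The element $s\in[2pk]=\{1,\ldots,2pk\}$ is colored by the $s$-th letter of $W^k$; an element colored by $j$ or $j^*$ carries the label $u_j$. For a noncrossing partition $\pi$ of $[2pk]$ and a block $V=\{s_1<\ldots<s_m\}$ put $\pi(s_i)=s_{i+1}$ for $i<m$ and $\pi(s_m)=s_1$. $\mathcal{NC}(W^k)$ is the set of noncrossing partitions $\pi$ of $[2pk]$ such that (i) (color adapted) for each $s$ either $\pi(s)\equiv s+1\pmod{2p}$ or $\pi(s)\equiv 2p-s+1\pmod{2p}$ (all blocks are then even), and (ii) (label adapted) all elements of each block carry the same label. **The set $\mathcal{NC}^2(\widetilde W^k)$.** Let $\widetilde W=12\ldots(2p)(2p)^*\ldots2^*1^*$, a word of length $4p$. The letters $2j-1,\,2j,\,(2j)^*,\,(2j-1)^*$ carry the label $u_j$, for $1\le j\le p$. $\mathcal{NC}^2(\widetilde W^k)$ is the set of noncrossing pair partitions of $[4pk]$ such that, when the element $s$ is colored by the $s$-th letter of $\widetilde W^k$, the two elements of each block carry the same label and are colored by $\{i,i^*\}$ for some $1\le i\le 2p$, or by $\{2i,2i+1\}$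 for some $1\le i\le p-1$, or by $\{(2i+1)^*,(2i)^*\}$ for some $1\le i\le p-1$. *)

theory Defs
  imports "HOL-Library.Disjoint_Sets" "HOL-Number_Theory.Cong"
begin

(* Letter j stands for j, Star j for j^*. *)
datatype letter = Letter nat | Star nat

fun idx :: "letter \<Rightarrow> nat" where
  "idx (Letter j) = j"
| "idx (Star j) = j"

definition sym_word :: "nat \<Rightarrow> letter list" where
  "sym_word n = map Letter [1..<Suc n] @ map Star (rev [1..<Suc n])"

(* The colour of s in {1..2nk} is the s-th letter, counted from 1, of the k-th power of sym_word n. *)
definition colour :: "nat \<Rightarrow> nat \<Rightarrow> nat \<Rightarrow> letter" where
  "colour n k s = concat (replicate k (sym_word n)) ! (s - 1)"

definition noncrossing :: "nat set set \<Rightarrow> bool" where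
  "noncrossing P \<longleftrightarrow>
     (\<forall>V\<in>P. \<forall>V'\<in>P. \<forall>a\<in>V. \<forall>b\<in>V'. \<forall>c\<in>V. \<forall>d\<in>V'. a < b \<and> b < c \<and> c < d \<longrightarrow> V = V')"

definition NC :: "nat \<Rightarrow> nat set set set" where
  "NC n = {P. partition_on {1..n} P \<and> noncrossing P}"

definition NC_pair :: "nat \<Rightarrow> nat set set set" where
  "NC_pair n = {P \<in> NC n. \<forall>V\<in>P. card V = 2}"

(* The cyclic successor of s in its block V; on singletons it is the identity. *)
definition block_succ :: "nat set \<Rightarrow> nat \<Rightarrow> nat" where
  "block_succ V s = (if s = Max V then Min V else Min {t \<in> V. s < t})"

(* The congruences are over int, since 2p - s + 1 may be negative. *)
definition colour_adapted :: "nat \<Rightarrow> nat set set \<Rightarrow> bool" where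
  "colour_adapted p P \<longleftrightarrow>
     (\<forall>V\<in>P. \<forall>s\<in>V.
        [int (block_succ V s) = int s + 1] (mod (2 * int p)) \<or>
        [int (block_succ V s) = 2 * int p - int s + 1] (mod (2 * int p)))"

definition label_adapted :: "(nat \<Rightarrow> 'a) \<Rightarrow> nat set set \<Rightarrow> bool" where
  "label_adapted lab P \<longleftrightarrow> (\<forall>V\<in>P. \<forall>s\<in>V. \<forall>t\<in>V. lab s = lab t)"

definition NC_W :: "nat \<Rightarrow> nat \<Rightarrow> (nat \<Rightarrow> 'a) \<Rightarrow> nat set set set" where
  "NC_W p k u =
     {P \<in> NC (2 * p * k). colour_adapted p P \<and> label_adapted (\<lambda>s. u (idx (colour p k s))) P}"

(* The doubled word is sym_word (2p); letters with index 2j - 1 or 2j carry the label u j,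
   that is, index i carries u ((i + 1) div 2). *)
definition NC2_W :: "nat \<Rightarrow> nat \<Rightarrow> (nat \<Rightarrow> 'a) \<Rightarrow> nat set set set" where
  "NC2_W p k u =
     {P \<in> NC_pair (4 * p * k).
        label_adapted (\<lambda>s. u ((idx (colour (2 * p) k s) + 1) div 2)) P \<and>
        (\<forall>V\<in>P.
           (\<exists>i\<in>{1..2 * p}. colour (2 * p) k ` V = {Letter i, Star i}) \<or>
           (\<exists>i\<in>{1..p - 1}. colour (2 * p) k ` V = {Letter (2 * i), Letter (2 * i + 1)}) \<or>
           (\<exists>i\<in>{1..p - 1}. colour (2 * p) k ` V = {Star (2 * i + 1), Star (2 * i)}))}"

end

theory Submission
  imports Defs
begin

text \<open>
  The bijection is the fattening of a noncrossing partition. Each point \<open>s\<close> of \<open>{1..n}\<close>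
  is doubled into the two points \<open>2s - 1\<close> and \<open>2s\<close>, thought of as lying just to its left and
  just to its right, and a block with cyclic successor map \<open>\<pi>\<close> is replaced by the pairs
  \<open>{2s, 2\<pi>(s) - 1}\<close>, which trace the boundary of the block. Doubling \<open>W\<close> letter by letter
  in this way gives the second word: position \<open>s\<close> of colour \<open>j\<close> becomes \<open>2j - 1, 2j\<close>, and
  position \<open>s\<close> of colour \<open>j\<^sup>*\<close> becomes \<open>(2j)\<^sup>*, (2j - 1)\<^sup>*\<close>. Both conditions on the
  partition only involve consecutive elements \<open>s, \<pi>(s)\<close>: this is how colour adaptedness is
  phrased, and labels are constant on a block iff they do not change along \<open>\<pi>\<close>. So each of them
  is equivalent to a condition on the single pair \<open>{2s, 2\<pi>(s) - 1}\<close>, and these turn out to be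
  the conditions imposed on the pair partition (\<open>matching_colours_arc_iff\<close>,
  \<open>label_adapted_fatten_iff\<close>).

  There remains the fact that fattening is a bijection from the noncrossing partitions of
  \<open>{1..n}\<close> to the noncrossing pair partitions of \<open>{1..2n}\<close> (\<open>bij_betw_fatten\<close>). All of it
  rests on one relation: a pair \<open>encloses\<close> the point \<open>s\<close> if it has one end on either side of the
  midpoint of \<open>2s - 1\<close> and \<open>2s\<close>. Drawing pairs as arcs, two points lie in the same region of
  the complement iff they are enclosed by the same arcs. The blocks of a noncrossing partition
  are exactly the regions cut out by its fattening (\<open>region_fatten\<close>), which gives injectivity.
  For surjectivity, the regions of any family of pairs form a noncrossing partition, simply
  because the sets of enclosed points are intervals (\<open>regions_in_NC\<close>). If the family is a
  noncrossing pair partition, an even number of points lies strictly inside each pair, so its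
  two ends have different parity and it has the form \<open>{2s, 2t - 1}\<close> (\<open>NC_pair_is_arc\<close>); then
  \<open>t\<close> is the successor of \<open>s\<close> in its region (\<open>block_succ_region\<close>), so fattening the regions
  gives the pair partition back.
\<close>

section \<open>Cyclic successors in a finite block\<close>

definition arc :: "nat \<Rightarrow> nat \<Rightarrow> nat set" where
  "arc s t = {2 * s, 2 * t - 1}"

text \<open>The end \<open>2s\<close> belongs to the right half of the doubled point \<open>s\<close>, so a pair starting there
  does not enclose \<open>s\<close>, whereas a pair ending there does; the left half \<open>2s - 1\<close> behaves in the
  mirrored way. Hence the mixture of strict and weak inequality.\<close>

definition encloses :: "nat set \<Rightarrow> nat \<Rightarrow> bool" where
  "encloses e s \<longleftrightarrow> Min e < 2 * s \<and> 2 * s \<le> Max e"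

lemma encloses_pair:
  "x < z \<Longrightarrow> encloses {x, z} s \<longleftrightarrow> x < 2 * s \<and> 2 * s \<le> z"
  by (simp add: encloses_def)

lemma encloses_arc:
  assumes "1 \<le> t"
  shows "encloses (arc s t) r \<longleftrightarrow> (if s < t then s < r \<and> r < t else t \<le> r \<and> r \<le> s)"
  using assms by (auto simp: encloses_def arc_def min_def max_def)

lemma card_arc: "1 \<le> t \<Longrightarrow> card (arc s t) = 2"
proof -
  assume "1 \<le> t"
  then have "2 * s \<noteq> 2 * t - 1" by presburger
  then show ?thesis by (simp add: arc_def)
qed

lemma even_mem_arc:
  assumes "1 \<le> t"
  shows "2 * r \<in> arc s t \<longleftrightarrow> r = s"
  using assms unfolding arc_def by (auto; presburger)

lemma odd_mem_arc:
  assumes "1 \<le> t" "1 \<le> r"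
  shows "2 * r - 1 \<in> arc s t \<longleftrightarrow> r = t"
  using assms unfolding arc_def by (auto; presburger)

lemma block_succ_Max: "block_succ V (Max V) = Min V"
  by (simp add: block_succ_def)

lemma block_succ_mem:
  assumes "finite V" "s \<in> V"
  shows "block_succ V s \<in> V"
proof (cases "s = Max V")
  case True
  then show ?thesis using assms by (metis Min_in block_succ_Max empty_iff)
next
  case False
  then have "s < Max V" using assms by (simp add: le_neq_implies_less)
  then have "{t \<in> V. s < t} \<noteq> {}" using assms Max_in by blast
  then have "Min {t \<in> V. s < t} \<in> {t \<in> V. s < t}" using assms by (intro Min_in) auto
  then show ?thesis using False by (simp add: block_succ_def)
qed

text \<open>The order-theoretic cases of the cyclic successor (next element, or wrapping around from the
  maximum to the minimum) merge into one statement about arcs: the arc of an ordinary step jumps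
  over a gap and encloses nothing of the block, and the arc of the wrapping step goes around the
  whole block. In this form the successor can be read off from the enclosure relation alone.\<close>

lemma block_succ_eq_iff:
  assumes "finite V" "s \<in> V" "t \<in> V" "1 \<le> t"
  shows "block_succ V s = t \<longleftrightarrow> (\<forall>r\<in>V. encloses (arc s t) r \<longleftrightarrow> t \<le> s)"
proof (cases "s = Max V")
  case True
  have "s < t \<Longrightarrow> False" using True assms by (simp add: Max.coboundedI leD)
  then have "t \<le> s" by force
  moreover have "Min V = t \<longleftrightarrow> (\<forall>r\<in>V. t \<le> r)" using assms by (metis Min_eqI Min_le)
  ultimately show ?thesis using True assms by (auto simp: block_succ_def encloses_arc)
next
  case False
  then have sm: "s < Max V" using assms by (simp add: le_neq_implies_less)
  have mx: "Max V \<in> V" using assms by (auto intro: Max_in)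
  let ?A = "{t \<in> V. s < t}"
  have fin: "finite ?A" and ne: "?A \<noteq> {}" using assms sm mx by auto
  have in1: "Min ?A \<in> ?A" using fin ne by (rule Min_in)
  have eq: "block_succ V s = Min ?A" using False by (simp add: block_succ_def)
  show ?thesis
  proof (cases "s < t")
    case True
    have "Min ?A = t \<longleftrightarrow> (\<forall>r\<in>V. \<not> (s < r \<and> r < t))"
    proof
      assume "Min ?A = t"
      then show "\<forall>r\<in>V. \<not> (s < r \<and> r < t)" using Min_le[OF fin] by fastforce
    next
      assume "\<forall>r\<in>V. \<not> (s < r \<and> r < t)"
      then show "Min ?A = t" using fin True assms by (intro Min_eqI) auto
    qed
    then show ?thesis using eq True assms by (simp add: encloses_arc)
  next
    case nl: False
    then have "block_succ V s \<noteq> t" using in1 eq by auto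
    moreover have "\<not> encloses (arc s t) (Max V)" using nl sm assms by (simp add: encloses_arc)
    ultimately show ?thesis using nl mx by auto
  qed
qed

lemma block_succ_predecessor:
  assumes "finite V" "t \<in> V" "Min V < t" "1 \<le> t"
  shows "\<exists>s\<in>V. s < t \<and> block_succ V s = t"
proof -
  let ?B = "{s \<in> V. s < t}"
  have fin: "finite ?B" and ne: "?B \<noteq> {}" using assms by (auto intro: Min_in)
  have mem: "Max ?B \<in> ?B" using fin ne by (rule Max_in)
  have "block_succ V (Max ?B) = t"
    using assms mem Max_ge[OF fin] by (subst block_succ_eq_iff) (fastforce simp: encloses_arc)+
  then show ?thesis using mem by blast
qed

lemma block_succ_inj_on:
  assumes "finite V" "0 \<notin> V"
  shows "inj_on (block_succ V) V"
proof (rule eq_card_imp_inj_on)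
  have "V \<subseteq> block_succ V ` V"
  proof
    fix t assume t: "t \<in> V"
    show "t \<in> block_succ V ` V"
    proof (cases "t = Min V")
      case True
      have "Max V \<in> V" using t assms by (auto intro: Max_in)
      then show ?thesis using block_succ_Max True by (metis imageI)
    next
      case False
      then have "Min V < t" using t assms by (simp add: le_neq_implies_less)
      moreover have "1 \<le> t" using t assms by (cases t) auto
      ultimately show ?thesis using block_succ_predecessor[of V t] t assms by blast
    qed
  qed
  then have "block_succ V ` V = V" using assms by (auto simp: block_succ_mem)
  then show "card (block_succ V ` V) = card V" by simp
qed (fact assms(1))

text \<open>Following the successor map reaches every element of the block from its minimum, so a function
  that is preserved by single steps is constant.\<close>

lemma constant_on_block_iff:
  assumes "finite V" "0 \<notin> V"
  shows "(\<forall>s\<in>V. \<forall>t\<in>V. f s = f t) \<longleftrightarrow> (\<forall>s\<in>V. f s = f (block_succ V s))"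
proof
  assume "\<forall>s\<in>V. \<forall>t\<in>V. f s = f t"
  then show "\<forall>s\<in>V. f s = f (block_succ V s)" using assms by (blast intro: block_succ_mem)
next
  assume step: "\<forall>s\<in>V. f s = f (block_succ V s)"
  have "t \<in> V \<Longrightarrow> f t = f (Min V)" for t
  proof (induction t rule: less_induct)
    case (less t)
    show ?case
    proof (cases "t = Min V")
      case False
      then have "Min V < t" using less.prems assms by (simp add: le_neq_implies_less)
      moreover have "1 \<le> t" using less.prems assms by (cases t) auto
      ultimately obtain s where "s \<in> V" "s < t" "block_succ V s = t"
        using block_succ_predecessor[of V t] less.prems assms by blast
      then show ?thesis using step less.IH by metis
    qed simp
  qed
  then show "\<forall>s\<in>V. \<forall>t\<in>V. f s = f t" by simp
qed

section \<open>Fattening a noncrossing partition\<close>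

definition fatten :: "nat set set \<Rightarrow> nat set set" where
  "fatten P = {arc s (block_succ V s) | V s. V \<in> P \<and> s \<in> V}"

lemma NC_blockD:
  assumes "P \<in> NC n" "V \<in> P"
  shows "finite V" "V \<subseteq> {1..n}" "0 \<notin> V" "V \<noteq> {}"
proof -
  show sub: "V \<subseteq> {1..n}" and "V \<noteq> {}"
    using assms by (auto simp: NC_def partition_on_def)
  show "finite V" using sub by (rule finite_subset) simp
  show "0 \<notin> V" using sub by auto
qed

lemma block_succ_bounds:
  assumes "P \<in> NC n" "V \<in> P" "s \<in> V"
  shows "1 \<le> block_succ V s" "block_succ V s \<le> n" "block_succ V s \<in> V"
  using NC_blockD[OF assms(1,2)] block_succ_mem[of V s] assms(3) by auto

lemma NC_block_eq:
  assumes "P \<in> NC n" "V \<in> P" "V' \<in> P" "s \<in> V" "s \<in> V'"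
  shows "V = V'"
  using assms by (auto simp: NC_def partition_on_def disjoint_def)

lemma NC_noncrossingD:
  assumes "P \<in> NC n" "V \<in> P" "V' \<in> P" "a \<in> V" "b \<in> V'" "c \<in> V" "d \<in> V'"
    "a < b" "b < c" "c < d"
  shows "V = V'"
  using assms unfolding NC_def noncrossing_def by blast

text \<open>An arc of the block of \<open>s\<close> encloses all or nothing of that block by \<open>block_succ_eq_iff\<close>. If it
  separated two elements \<open>c\<close>, \<open>d\<close> of another block, then \<open>c\<close> would lie between \<open>s\<close> and its
  successor and \<open>d\<close> outside, and the two blocks would cross.\<close>

lemma fattened_arc_does_not_separate:
  assumes P: "P \<in> NC n" and V: "V \<in> P" "s \<in> V" and W: "W \<in> P" "a \<in> W" "b \<in> W"
  shows "encloses (arc s (block_succ V s)) a \<longleftrightarrow> encloses (arc s (block_succ V s)) b"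
proof (cases "W = V")
  case True
  then show ?thesis
    using block_succ_eq_iff[of V s "block_succ V s"] NC_blockD[OF P V(1)] V W
      block_succ_bounds[OF P V] by blast
next
  case False
  let ?t = "block_succ V s"
  note t = block_succ_bounds[OF P V]
  have off: "c \<noteq> s" "c \<noteq> ?t" if "c \<in> W" for c
    using NC_block_eq[OF P V(1) W(1)] that V(2) t(3) False by auto
  have no: False if "c \<in> W" "d \<in> W" "encloses (arc s ?t) c" "\<not> encloses (arc s ?t) d" for c d
  proof (cases "s < ?t")
    case True
    then have "s < c" "c < ?t" "d < s \<or> ?t < d"
      using that off[of d] t(1) by (auto simp: encloses_arc)
    then show False
      using NC_noncrossingD[OF P V(1) W(1), of s c ?t d] NC_noncrossingD[OF P W(1) V(1), of d s c ?t]
        that V(2) t(3) False by blast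
  next
    case F: False
    then have "?t < c" "c < s" "d < ?t \<or> s < d"
      using that off[of c] t(1) by (auto simp: encloses_arc)
    then show False
      using NC_noncrossingD[OF P V(1) W(1), of ?t c s d] NC_noncrossingD[OF P W(1) V(1), of d ?t c s]
        that V(2) t(3) False by blast
  qed
  show ?thesis using no W by blast
qed

text \<open>A point \<open>b\<close> outside the range of the block is separated from it by the arc around the whole
  block, and a point \<open>b\<close> in a gap by the arc over that gap.\<close>

lemma fattened_arc_separates:
  assumes P: "P \<in> NC n" and V: "V \<in> P" "a \<in> V" and b: "b \<notin> V"
  shows "\<exists>s\<in>V. encloses (arc s (block_succ V s)) a \<noteq> encloses (arc s (block_succ V s)) b"
proof -
  note fin = NC_blockD[OF P V(1)]
  have Min: "Min V \<in> V" "Min V \<le> a" and Max: "Max V \<in> V" "a \<le> Max V"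
    using fin V(2) by auto
  have Min1: "1 \<le> Min V" using Min fin by auto
  show ?thesis
  proof (cases "b < Min V \<or> Max V < b")
    case True
    then show ?thesis
      using Min Max Min1 by (intro bexI[of _ "Max V"]) (auto simp: block_succ_Max encloses_arc)
  next
    case False
    let ?B = "{s \<in> V. s < b}"
    have "Min V < b" using False b Min by (metis linorder_neqE_nat)
    then have ne: "?B \<noteq> {}" using Min(1) by blast
    have finB: "finite ?B" using fin by simp
    let ?s = "Max ?B"
    have s: "?s \<in> V" "?s < b" using Max_in[OF finB ne] by auto
    let ?t = "block_succ V ?s"
    note t = block_succ_bounds[OF P V(1) s(1)]
    have "?s \<noteq> Max V" using False s b Max by auto
    then have lt: "?s < Max V" using Max_ge[OF fin(1) s(1)] by simp
    have all: "\<forall>r\<in>V. encloses (arc ?s ?t) r \<longleftrightarrow> ?t \<le> ?s"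
      using block_succ_eq_iff[OF fin(1) s(1) t(3) t(1)] by blast
    have st: "?s < ?t"
    proof (rule ccontr)
      assume "\<not> ?s < ?t"
      then have "encloses (arc ?s ?t) (Max V)" using all Max(1) by simp
      then show False using \<open>\<not> ?s < ?t\<close> lt t(1) by (simp add: encloses_arc)
    qed
    then have na: "\<not> encloses (arc ?s ?t) a" using all V(2) by simp
    have "b < ?t"
    proof (rule ccontr)
      assume "\<not> b < ?t"
      then have "?t \<in> ?B" using t(3) b by (metis (mono_tags, lifting) mem_Collect_eq linorder_neqE_nat)
      then show False using Max_ge[OF finB] st by (metis leD)
    qed
    then have "encloses (arc ?s ?t) b" using st s t by (simp add: encloses_arc)
    then show ?thesis using na s by blast
  qed
qed

text \<open>Away from the ends of the pair, it does not matter whether a doubled point is tested by either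
  of its halves or by the midpoint between them. This transfers questions about crossing pairs to
  the enclosure relation.\<close>

lemma pair_encloses_endpoint:
  assumes "x < z" "1 \<le> s" "y = 2 * s \<or> y = 2 * s - 1" "y \<noteq> x" "y \<noteq> z"
  shows "encloses {x, z} s \<longleftrightarrow> x < y \<and> y < (z::nat)"
  using assms by (auto simp: encloses_pair)

text \<open>The even end of an arc determines where it starts. Its odd end determines the successor and
  with it the block, on which the successor map is injective.\<close>

lemma fatten_arc_unique:
  assumes P: "P \<in> NC n" and V: "V \<in> P" "s \<in> V" and V': "V' \<in> P" "s' \<in> V'"
    and y: "y \<in> arc s (block_succ V s)" "y \<in> arc s' (block_succ V' s')"
  shows "V = V'" "s = s'"
proof -
  let ?t = "block_succ V s" and ?t' = "block_succ V' s'"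
  note t = block_succ_bounds[OF P V] and t' = block_succ_bounds[OF P V']
  have "y = 2 * s \<or> y = 2 * ?t - 1" using y(1) by (auto simp: arc_def)
  then have "s = s' \<or> ?t = ?t'"
    using y(2) even_mem_arc[OF t'(1), of s s'] odd_mem_arc[OF t'(1) t(1), of s'] by metis
  then show "V = V'" using NC_block_eq[OF P V(1) V'(1)] V(2) V'(2) t(3) t'(3) by metis
  then show "s = s'"
    using \<open>s = s' \<or> ?t = ?t'\<close> block_succ_inj_on[of V] NC_blockD[OF P V(1)] V V'
    by (metis inj_onD)
qed

text \<open>If two arcs crossed, exactly one end of the second would lie inside the first. The ends of the
  second arc sit next to two elements of one block, so the first arc would separate these two
  elements.\<close>

lemma noncrossing_fatten:
  assumes P: "P \<in> NC n"
  shows "noncrossing (fatten P)"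
  unfolding noncrossing_def
proof (intro ballI impI)
  fix e e' x y z w
  assume e: "e \<in> fatten P" "e' \<in> fatten P" and mem: "x \<in> e" "y \<in> e'" "z \<in> e" "w \<in> e'"
    and lt: "x < y \<and> y < z \<and> z < w"
  from e(1) obtain V s where V: "V \<in> P" "s \<in> V" and es: "e = arc s (block_succ V s)"
    unfolding fatten_def by blast
  from e(2) obtain W r where W: "W \<in> P" "r \<in> W" and er: "e' = arc r (block_succ W r)"
    unfolding fatten_def by blast
  let ?q = "block_succ W r"
  note q = block_succ_bounds[OF P W]
  show "e = e'"
  proof (rule ccontr)
    assume ne: "e \<noteq> e'"
    have dis: "e \<inter> e' = {}" using fatten_arc_unique[OF P V W] es er ne by blast
    have exz: "e = {x, z}" using mem lt es unfolding arc_def by auto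
    have "{y, w} = {2 * r, 2 * ?q - 1}" using mem lt er unfolding arc_def by auto
    moreover have "1 \<le> r" using W NC_blockD[OF P W(1)] by auto
    ultimately have "\<exists>a b. a \<in> W \<and> b \<in> W \<and> 1 \<le> a \<and> 1 \<le> b \<and>
        (y = 2 * a \<or> y = 2 * a - 1) \<and> (w = 2 * b \<or> w = 2 * b - 1)"
      using W q by (auto simp: doubleton_eq_iff)
    then obtain a b where ab: "a \<in> W" "b \<in> W" "1 \<le> a" "1 \<le> b"
        "y = 2 * a \<or> y = 2 * a - 1" "w = 2 * b \<or> w = 2 * b - 1" by blast
    have "y \<notin> {x, z}" "w \<notin> {x, z}" using dis exz mem by auto
    then have "encloses e a" "\<not> encloses e b"
      using pair_encloses_endpoint[of x z a y] pair_encloses_endpoint[of x z b w] ab lt exz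
      by auto
    then show False using fattened_arc_does_not_separate[OF P V W(1) ab(1,2)] es by simp
  qed
qed

lemma Union_fatten:
  assumes P: "P \<in> NC n"
  shows "\<Union> (fatten P) = {1..2 * n}"
proof (rule set_eqI)
  have U: "\<Union> P = {1..n}" using P by (simp add: NC_def partition_on_def)
  fix y
  show "y \<in> \<Union> (fatten P) \<longleftrightarrow> y \<in> {1..2 * n}"
  proof
    assume "y \<in> \<Union> (fatten P)"
    then obtain V s where V: "V \<in> P" "s \<in> V" "y \<in> arc s (block_succ V s)"
      unfolding fatten_def by blast
    then have "1 \<le> s" "s \<le> n" using NC_blockD(2)[OF P V(1)] by auto
    then show "y \<in> {1..2 * n}"
      using V block_succ_bounds[OF P V(1,2)] unfolding arc_def by auto
  next
    assume y: "y \<in> {1..2 * n}"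
    define t where "t = (y + 1) div 2"
    have "t \<in> {1..n}" using y by (auto simp: t_def)
    then obtain V where V: "V \<in> P" "t \<in> V" using U by blast
    note fin = NC_blockD[OF P V(1)]
    show "y \<in> \<Union> (fatten P)"
    proof (cases "even y")
      case True
      then have "y = 2 * t" by (auto simp: t_def)
      then show ?thesis using V unfolding fatten_def arc_def by blast
    next
      case False
      then have yt: "y = 2 * t - 1" by (auto simp: t_def elim: oddE)
      have "block_succ V ` V = V"
        using block_succ_inj_on[OF fin(1,3)] fin(1)
        by (intro endo_inj_surj) (auto simp: block_succ_mem)
      then obtain s where "s \<in> V" "block_succ V s = t" using V by (metis imageE)
      then show ?thesis using V yt unfolding fatten_def arc_def by blast
    qed
  qed
qed

lemma fatten_in_NC_pair:
  assumes P: "P \<in> NC n"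
  shows "fatten P \<in> NC_pair (2 * n)"
proof -
  have card: "card e = 2" if "e \<in> fatten P" for e
    using that block_succ_bounds[OF P] card_arc unfolding fatten_def by blast
  have "disjoint (fatten P)"
    unfolding disjoint_def
  proof (intro ballI impI)
    fix e e' assume e: "e \<in> fatten P" "e' \<in> fatten P" "e \<noteq> e'"
    then show "e \<inter> e' = {}" using fatten_arc_unique[OF P] unfolding fatten_def by blast
  qed
  moreover have "{} \<notin> fatten P" using card by fastforce
  ultimately have "partition_on {1..2 * n} (fatten P)"
    using Union_fatten[OF P] by (simp add: partition_on_def)
  then show ?thesis using noncrossing_fatten[OF P] card by (simp add: NC_pair_def NC_def)
qed

section \<open>Recovering the partition from its arcs\<close>

definition region :: "nat \<Rightarrow> nat set set \<Rightarrow> nat \<Rightarrow> nat set" where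
  "region n Q s = {t \<in> {1..n}. \<forall>e\<in>Q. encloses e s \<longleftrightarrow> encloses e t}"

lemma region_fatten:
  assumes P: "P \<in> NC n" and V: "V \<in> P" "s \<in> V"
  shows "region n (fatten P) s = V"
proof (rule set_eqI)
  fix t
  show "t \<in> region n (fatten P) s \<longleftrightarrow> t \<in> V"
  proof
    assume "t \<in> region n (fatten P) s"
    then have "\<forall>r\<in>V. encloses (arc r (block_succ V r)) s = encloses (arc r (block_succ V r)) t"
      using V unfolding region_def fatten_def by blast
    then show "t \<in> V" using fattened_arc_separates[OF P V] by blast
  next
    assume t: "t \<in> V"
    then have "t \<in> {1..n}" using NC_blockD(2)[OF P V(1)] by blast
    then show "t \<in> region n (fatten P) s"
      using fattened_arc_does_not_separate[OF P _ _ V(1) V(2) t]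
      unfolding region_def fatten_def by blast
  qed
qed

lemma fatten_inj_on: "inj_on fatten (NC n)"
proof (rule inj_onI)
  have sub: "P \<subseteq> P'" if P: "P \<in> NC n" "P' \<in> NC n" and eq: "fatten P = fatten P'" for P P'
  proof
    fix V assume V: "V \<in> P"
    then obtain s where s: "s \<in> V" using NC_blockD(4)[OF P(1)] by blast
    then have "s \<in> \<Union> P'" using NC_blockD(2)[OF P(1) V] P(2) by (auto simp: NC_def partition_on_def)
    then obtain V' where V': "V' \<in> P'" "s \<in> V'" by blast
    have "V = V'" using region_fatten[OF P(1) V s] region_fatten[OF P(2) V'] eq by simp
    then show "V \<in> P'" using V' by simp
  qed
  fix P P' assume "P \<in> NC n" "P' \<in> NC n" "fatten P = fatten P'"
  then show "P = P'" using sub[of P P'] sub[of P' P] by simp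
qed

text \<open>The points enclosed by a pair form an interval. If \<open>a < b < c < d\<close> with \<open>a, c\<close> in one region
  and \<open>b, d\<close> in another, a pair enclosing \<open>a\<close> also encloses \<open>c\<close> and therefore \<open>b\<close>, and a pair
  enclosing \<open>b\<close> also encloses \<open>d\<close> and therefore \<open>c\<close>, hence \<open>a\<close>; so the two regions agree.\<close>

lemma regions_in_NC: "region n Q ` {1..n} \<in> NC n"
proof -
  have self: "s \<in> region n Q s" if "s \<in> {1..n}" for s using that by (simp add: region_def)
  have eq: "region n Q s = region n Q t" if "r \<in> region n Q s" "r \<in> region n Q t" for r s t
    using that by (auto simp: region_def)
  have "partition_on {1..n} (region n Q ` {1..n})"
  proof (rule partition_onI)
    show "\<Union> (region n Q ` {1..n}) = {1..n}" using self by (auto simp: region_def)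
    show "disjnt V W" if "V \<in> region n Q ` {1..n}" "W \<in> region n Q ` {1..n}" "V \<noteq> W" for V W
    proof -
      from that obtain s t where "V = region n Q s" "W = region n Q t" by blast
      then show ?thesis using eq that(3) unfolding disjnt_def by blast
    qed
    show "{} \<notin> region n Q ` {1..n}" using self by (metis empty_iff imageE)
  qed
  moreover have "noncrossing (region n Q ` {1..n})"
    unfolding noncrossing_def
  proof (intro ballI impI)
    fix V W a b c d
    assume V: "V \<in> region n Q ` {1..n}" and W: "W \<in> region n Q ` {1..n}"
      and mem: "a \<in> V" "b \<in> W" "c \<in> V" "d \<in> W" and lt: "a < b \<and> b < c \<and> c < d"
    from V W obtain s t where st: "V = region n Q s" "W = region n Q t" by blast
    have "encloses e a = encloses e b" if "e \<in> Q" for e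
    proof -
      have "encloses e a = encloses e c" "encloses e b = encloses e d"
        using mem that st unfolding region_def by blast+
      then show ?thesis using lt by (auto simp: encloses_def)
    qed
    then have "a \<in> region n Q t" using mem st by (auto simp: region_def)
    then show "V = W" using eq mem st by metis
  qed
  ultimately show ?thesis by (simp add: NC_def)
qed

text \<open>The points strictly between the two ends of a pair are matched among themselves, since a pair
  leaving this interval would cross. Their number is therefore even, and the ends have different
  parity.\<close>

lemma NC_pair_is_arc:
  assumes Q: "Q \<in> NC_pair (2 * n)" and e: "e \<in> Q"
  shows "\<exists>s\<in>{1..n}. \<exists>t\<in>{1..n}. e = arc s t"
proof -
  have NC: "Q \<in> NC (2 * n)" and card2: "\<And>e. e \<in> Q \<Longrightarrow> card e = 2"
    using Q by (auto simp: NC_pair_def)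
  obtain x z where xz: "x < z" "e = {x, z}"
    using card2[OF e] by (metis card_2_iff insert_commute linorder_neqE_nat)
  have bounds: "1 \<le> x" "z \<le> 2 * n" using NC_blockD(2)[OF NC e] xz by auto
  define I where "I = {f \<in> Q. f \<subseteq> {x<..<z}}"
  have inside: "f \<subseteq> {x<..<z}" if f: "f \<in> Q" and y: "y \<in> f" "x < y" "y < z" for f y
  proof
    fix w assume w: "w \<in> f"
    have fe: "f \<noteq> e" using y xz by auto
    then have "w \<noteq> x" "w \<noteq> z" using NC_block_eq[OF NC e f, of w] w xz by auto
    moreover have "\<not> z < w"
      using NC_noncrossingD[OF NC e f, of x y z w] y w xz fe by auto
    moreover have "\<not> w < x"
      using NC_noncrossingD[OF NC f e, of w x y z] y w xz fe by auto
    ultimately show "w \<in> {x<..<z}" by auto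
  qed
  have "{x<..<z} \<subseteq> \<Union> Q" using NC bounds by (auto simp: NC_def partition_on_def)
  then have "\<Union> I = {x<..<z}"
  proof (intro equalityI subsetI)
    fix y assume y: "y \<in> {x<..<z}"
    with \<open>{x<..<z} \<subseteq> \<Union> Q\<close> obtain f where "f \<in> Q" "y \<in> f" by blast
    then show "y \<in> \<Union> I" using inside[of f y] y by (auto simp: I_def)
  qed (auto simp: I_def)
  moreover have "finite I"
  proof -
    have "I \<subseteq> Pow {x<..<z}" unfolding I_def by blast
    then show ?thesis by (rule finite_subset) simp
  qed
  moreover have "pairwise disjnt I"
    using NC_block_eq[OF NC] unfolding pairwise_def disjnt_def I_def by blast
  moreover have "\<And>f. f \<in> I \<Longrightarrow> finite f"
    using NC_blockD(1)[OF NC] unfolding I_def by blast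
  ultimately have "card {x<..<z} = (\<Sum>f\<in>I. card f)"
    using card_Union_disjoint[of I] by simp
  also have "\<dots> = 2 * card I" using card2 by (simp add: I_def)
  finally have "z - Suc x = 2 * card I" by simp
  then have zx: "z = 2 * card I + x + 1" using xz by simp
  show ?thesis
  proof (cases "even x")
    case True
    then obtain s where s: "x = 2 * s" by blast
    let ?t = "card I + s + 1"
    have "s \<in> {1..n}" "?t \<in> {1..n}" "e = arc s ?t"
      using bounds s zx xz by (auto simp: arc_def)
    then show ?thesis by blast
  next
    case False
    then obtain t where t: "x = 2 * t + 1" by (blast elim: oddE)
    let ?s = "card I + t + 1"
    have "?s \<in> {1..n}" "t + 1 \<in> {1..n}" "e = arc ?s (t + 1)"
      using bounds t zx xz by (auto simp: arc_def)
    then show ?thesis by blast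
  qed
qed

text \<open>No other pair of a noncrossing partition has just one of the ends of the arc from \<open>s\<close> to \<open>t\<close>
  inside, so no other pair separates \<open>s\<close> from \<open>t\<close>, and neither does the arc itself: it encloses
  both or none of them. Thus \<open>t\<close> lies in the region of \<open>s\<close>; the arc encloses all or nothing of
  this region, and \<open>block_succ_eq_iff\<close> identifies \<open>t\<close> as the successor.\<close>

lemma block_succ_region:
  assumes Q: "Q \<in> NC_pair (2 * n)" and e: "arc s t \<in> Q" and st: "s \<in> {1..n}" "t \<in> {1..n}"
  shows "block_succ (region n Q s) s = t"
proof -
  have NC: "Q \<in> NC (2 * n)" and card2: "\<And>e. e \<in> Q \<Longrightarrow> card e = 2"
    using Q by (auto simp: NC_pair_def)
  have "encloses f s = encloses f t" if f: "f \<in> Q" for f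
  proof (cases "f = arc s t")
    case True
    then show ?thesis using st by (auto simp: encloses_arc)
  next
    case False
    obtain x z where xz: "x < z" "f = {x, z}"
      using card2[OF f] by (metis card_2_iff insert_commute linorder_neqE_nat)
    have off: "y \<noteq> x" "y \<noteq> z" if "y \<in> arc s t" for y
      using NC_block_eq[OF NC e f that] xz False by auto
    have mem: "2 * s \<in> arc s t" "2 * t - 1 \<in> arc s t" by (simp_all add: arc_def)
    have no: "\<not> (x < y \<and> y < z \<and> \<not> (x < w \<and> w < z))" if y: "y \<in> arc s t" "w \<in> arc s t" for y w
    proof
      assume "x < y \<and> y < z \<and> \<not> (x < w \<and> w < z)"
      then have "x < y" "y < z" "w < x \<or> z < w" using off[OF y(2)] by auto
      then show False
        using NC_noncrossingD[OF NC f e, of x y z w] NC_noncrossingD[OF NC e f, of w x y z] y xz False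
        by auto
    qed
    have "x < 2 * s \<and> 2 * s < z \<longleftrightarrow> x < 2 * t - 1 \<and> 2 * t - 1 < z"
      using no mem by blast
    then show ?thesis
      using pair_encloses_endpoint[OF xz(1), of s "2 * s"] pair_encloses_endpoint[OF xz(1), of t "2 * t - 1"]
        off[OF mem(1)] off[OF mem(2)] st xz(2) by simp
  qed
  then have t: "t \<in> region n Q s" using st by (simp add: region_def)
  have "encloses (arc s t) r \<longleftrightarrow> t \<le> s" if "r \<in> region n Q s" for r
  proof -
    have "encloses (arc s t) r \<longleftrightarrow> encloses (arc s t) s" using that e by (auto simp: region_def)
    then show ?thesis using st by (auto simp: encloses_arc)
  qed
  moreover have "finite (region n Q s)" "s \<in> region n Q s" using st by (simp_all add: region_def)
  ultimately show ?thesis using block_succ_eq_iff t st by auto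
qed

lemma fatten_regions:
  assumes Q: "Q \<in> NC_pair (2 * n)"
  shows "fatten (region n Q ` {1..n}) = Q"
proof -
  let ?P = "region n Q ` {1..n}"
  have P: "?P \<in> NC n" by (rule regions_in_NC)
  have self: "s \<in> region n Q s" if "s \<in> {1..n}" for s using that by (simp add: region_def)
  have NC: "Q \<in> NC (2 * n)" using Q by (simp add: NC_pair_def)
  show ?thesis
  proof
    show "Q \<subseteq> fatten ?P"
    proof
      fix e assume e: "e \<in> Q"
      then obtain s t where st: "s \<in> {1..n}" "t \<in> {1..n}" "e = arc s t"
        using NC_pair_is_arc[OF Q] by blast
      then have "e = arc s (block_succ (region n Q s) s)" using block_succ_region[OF Q] e by simp
      then show "e \<in> fatten ?P" using st self unfolding fatten_def by blast
    qed
    show "fatten ?P \<subseteq> Q"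
    proof
      fix e assume "e \<in> fatten ?P"
      then obtain V s where V: "V \<in> ?P" "s \<in> V" and e: "e = arc s (block_succ V s)"
        unfolding fatten_def by blast
      have s: "s \<in> {1..n}" using NC_blockD(2)[OF P V(1)] V(2) by blast
      have Vs: "V = region n Q s" using NC_block_eq[OF P V(1) _ V(2) self[OF s]] s by blast
      have "2 * s \<in> \<Union> Q" using NC s by (auto simp: NC_def partition_on_def)
      then obtain f where f: "f \<in> Q" "2 * s \<in> f" by blast
      then obtain s' t where st: "s' \<in> {1..n}" "t \<in> {1..n}" "f = arc s' t"
        using NC_pair_is_arc[OF Q] by blast
      then have "s' = s" using f(2) even_mem_arc by auto
      then have "f = e" using block_succ_region[OF Q, of s t] f st s e Vs by simp
      then show "e \<in> Q" using f by simp
    qed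
  qed
qed

lemma bij_betw_fatten: "bij_betw fatten (NC n) (NC_pair (2 * n))"
  unfolding bij_betw_def
proof
  show "inj_on fatten (NC n)" by (rule fatten_inj_on)
  show "fatten ` NC n = NC_pair (2 * n)"
    using fatten_in_NC_pair fatten_regions regions_in_NC by (metis image_eqI image_subsetI subsetI subset_antisym)
qed

section \<open>Colours and labels\<close>

lemma nth_concat_replicate:
  "i < k * length xs \<Longrightarrow> concat (replicate k xs) ! i = xs ! (i mod length xs)"
proof (induction k arbitrary: i)
  case (Suc k)
  show ?case
  proof (cases "i < length xs")
    case False
    then show ?thesis using Suc by (simp add: nth_append le_mod_geq)
  qed (simp add: nth_append)
qed simp

lemma colour_eq:
  assumes "1 \<le> s" "s \<le> 2 * n * k"
  shows "colour n k s =
    (let r = (s - 1) mod (2 * n) in if r < n then Letter (r + 1) else Star (2 * n - r))"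
proof -
  have len: "length (sym_word n) = 2 * n" by (simp add: sym_word_def)
  have n: "0 < n" using assms by (cases n) auto
  let ?r = "(s - 1) mod (2 * n)"
  have r: "?r < 2 * n" using n by simp
  have "colour n k s = sym_word n ! ?r"
    using nth_concat_replicate[of "s - 1" k "sym_word n"] assms len by (simp add: colour_def mult.commute)
  also have "\<dots> = (if ?r < n then Letter (?r + 1) else Star (2 * n - ?r))"
    using r by (auto simp: sym_word_def nth_append rev_nth simp del: upt_Suc)
  finally show ?thesis by (simp add: Let_def)
qed

text \<open>The colour of \<open>s\<close> is determined by \<open>a = (s - 1) mod 2p\<close>: it is \<open>a + 1\<close> if \<open>a < p\<close> and
  \<open>(2p - a)\<^sup>*\<close> otherwise. The next two lemmas express the colours of both halves of a doubled
  point by the same residue.\<close>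

lemma colour_doubled_even:
  assumes "1 \<le> s" "s \<le> 2 * p * k"
  shows "colour (2 * p) k (2 * s) =
    (let a = (s - 1) mod (2 * p) in if a < p then Letter (2 * a + 2) else Star (4 * p - 2 * a - 1))"
proof -
  have "(2 * s - 1) mod (2 * (2 * p)) = 2 * ((s - 1) mod (2 * p)) + 1"
  proof -
    have "2 * s - 1 = 2 * (s - 1) + 1" using assms by simp
    then show ?thesis by (simp only: mod_mult2_eq) simp
  qed
  moreover have "1 \<le> 2 * s" "2 * s \<le> 2 * (2 * p) * k" using assms by linarith+
  ultimately show ?thesis by (simp only: colour_eq Let_def) auto
qed

lemma colour_doubled_odd:
  assumes "1 \<le> t" "t \<le> 2 * p * k"
  shows "colour (2 * p) k (2 * t - 1) =
    (let b = (t - 1) mod (2 * p) in if b < p then Letter (2 * b + 1) else Star (4 * p - 2 * b))"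
proof -
  have "(2 * t - 1 - 1) mod (2 * (2 * p)) = 2 * ((t - 1) mod (2 * p))"
  proof -
    have "2 * t - 1 - 1 = 2 * (t - 1)" using assms by simp
    then show ?thesis by (simp only: mod_mult_mult1)
  qed
  moreover have "1 \<le> 2 * t - 1" "2 * t - 1 \<le> 2 * (2 * p) * k" using assms by linarith+
  ultimately show ?thesis by (simp only: colour_eq Let_def) auto
qed

lemma idx_colour_doubled:
  assumes "1 \<le> s" "s \<le> 2 * p * k"
  shows "(idx (colour (2 * p) k (2 * s)) + 1) div 2 = idx (colour p k s)"
    and "(idx (colour (2 * p) k (2 * s - 1)) + 1) div 2 = idx (colour p k s)"
proof -
  have "0 < p" using assms by (cases p) auto
  then have "(s - 1) mod (2 * p) < 2 * p" by simp
  then show "(idx (colour (2 * p) k (2 * s)) + 1) div 2 = idx (colour p k s)"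
    "(idx (colour (2 * p) k (2 * s - 1)) + 1) div 2 = idx (colour p k s)"
    unfolding colour_doubled_even[OF assms] colour_doubled_odd[OF assms] colour_eq[OF assms] Let_def
    by auto
qed

definition matching_colours :: "nat \<Rightarrow> letter set \<Rightarrow> bool" where
  "matching_colours p C \<longleftrightarrow>
     (\<exists>i\<in>{1..2 * p}. C = {Letter i, Star i}) \<or>
     (\<exists>i\<in>{1..p - 1}. C = {Letter (2 * i), Letter (2 * i + 1)}) \<or>
     (\<exists>i\<in>{1..p - 1}. C = {Star (2 * i + 1), Star (2 * i)})"

text \<open>Both congruences of the colour condition as equations between the residues that determine the
  colours. As the residues lie in \<open>{0..<2p}\<close>, the first congruence leaves the possibilities of
  stepping by one and of wrapping around, and the second a single one.\<close>

lemma cong_residues: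
  assumes "1 \<le> s" "1 \<le> t" "0 < p"
  defines "a \<equiv> (s - 1) mod (2 * p)" and "b \<equiv> (t - 1) mod (2 * p)"
  shows "[int t = int s + 1] (mod (2 * int p)) \<longleftrightarrow> b = a + 1 \<or> a = 2 * p - 1 \<and> b = 0"
    and "[int t = 2 * int p - int s + 1] (mod (2 * int p)) \<longleftrightarrow> a + b = 2 * p - 1"
proof -
  let ?m = "2 * int p"
  have ab: "a < 2 * p" "b < 2 * p" using assms(3) by (simp_all add: a_def b_def)
  have s: "[int s = int a + 1] (mod ?m)"
  proof -
    have "[int (s - 1) = int a] (mod ?m)" unfolding a_def cong_def by (simp add: zmod_int)
    then have "[int (s - 1) + 1 = int a + 1] (mod ?m)" by (rule cong_add) simp
    then show ?thesis using assms(1) by simp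
  qed
  have t: "[int t = int b + 1] (mod ?m)"
  proof -
    have "[int (t - 1) = int b] (mod ?m)" unfolding b_def cong_def by (simp add: zmod_int)
    then have "[int (t - 1) + 1 = int b + 1] (mod ?m)" by (rule cong_add) simp
    then show ?thesis using assms(2) by simp
  qed
  \<comment> \<open>The differences of residues considered below are larger than \<open>-4p\<close> and smaller than \<open>2p\<close>.\<close>
  have zero: "[x = 0] (mod ?m) \<longleftrightarrow> x = 0 \<or> x = - ?m" if "- 2 * ?m < x" "x < ?m" for x
  proof
    assume "[x = 0] (mod ?m)"
    then obtain c where c: "x = ?m * c" by (auto simp: cong_0_iff dvd_def)
    have "c < 1" using that(2) c assms(3) by (metis mult_less_cancel_left_pos mult.right_neutral of_nat_0_less_iff zero_less_mult_iff zero_less_numeral)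
    moreover have "-2 < c"
    proof (rule ccontr)
      assume "\<not> -2 < c"
      then have "?m * c \<le> ?m * -2" by (intro mult_left_mono) auto
      then show False using that(1) c by simp
    qed
    ultimately have "c = 0 \<or> c = -1" by auto
    then show "x = 0 \<or> x = - ?m" using c by auto
  qed (auto simp: cong_0_iff)
  have "[int t = int s + 1] (mod ?m) \<longleftrightarrow> [int b + 1 = int a + 1 + 1] (mod ?m)"
    using s t by (meson cong_add_rcancel cong_sym cong_trans)
  also have "\<dots> \<longleftrightarrow> [int b - int a - 1 = 0] (mod ?m)"
    by (simp add: cong_iff_dvd_diff algebra_simps)
  also have "\<dots> \<longleftrightarrow> b = a + 1 \<or> a = 2 * p - 1 \<and> b = 0"
    using ab by (subst zero) auto
  finally show "[int t = int s + 1] (mod ?m) \<longleftrightarrow> b = a + 1 \<or> a = 2 * p - 1 \<and> b = 0" .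
  have "[int t = ?m - int s + 1] (mod ?m) \<longleftrightarrow> [int t + int s - 1 - ?m = 0] (mod ?m)"
    by (simp add: cong_iff_dvd_diff algebra_simps)
  also have "\<dots> \<longleftrightarrow> [int b + 1 + (int a + 1) - 1 - ?m = 0] (mod ?m)"
    using cong_diff[OF cong_diff[OF cong_add[OF t s] cong_refl] cong_refl] 
    by (meson cong_sym cong_trans)
  also have "\<dots> \<longleftrightarrow> a + b = 2 * p - 1"
    using ab by (subst zero) auto
  finally show "[int t = ?m - int s + 1] (mod ?m) \<longleftrightarrow> a + b = 2 * p - 1" .
qed

text \<open>An arc joins an even position to an odd one. An even position carries an even letter or
  an odd starred letter, and an odd position the reverse. So for two
  letters or two stars only the colours \<open>{2i, 2i + 1}\<close> or their starred versions are possible,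
  which means stepping from one residue to the next within the same half of \<open>W\<close>; for a letter and
  a star only \<open>{i, i\<^sup>*}\<close> is possible, which means that the residues are mirror images. The
  steps from \<open>p\<close> to \<open>p\<^sup>*\<close> and from \<open>1\<^sup>*\<close> to \<open>1\<close> fall under both congruences.\<close>

lemma matching_colours_arc_iff:
  assumes "s \<in> {1..2 * p * k}" "t \<in> {1..2 * p * k}"
  shows "matching_colours p (colour (2 * p) k ` arc s t) \<longleftrightarrow>
    [int t = int s + 1] (mod (2 * int p)) \<or> [int t = 2 * int p - int s + 1] (mod (2 * int p))"
proof -
  have p: "0 < p" using assms by (cases p) auto
  define a b where "a = (s - 1) mod (2 * p)" and "b = (t - 1) mod (2 * p)"
  have ab: "a < 2 * p" "b < 2 * p" using p by (simp_all add: a_def b_def)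
  have img: "colour (2 * p) k ` arc s t =
    {if a < p then Letter (2 * a + 2) else Star (4 * p - 2 * a - 1),
     if b < p then Letter (2 * b + 1) else Star (4 * p - 2 * b)}"
    using assms colour_doubled_even[of s p k] colour_doubled_odd[of t p k]
    by (simp add: arc_def a_def b_def Let_def)
  have "matching_colours p (colour (2 * p) k ` arc s t) \<longleftrightarrow>
    (b = a + 1 \<or> a = 2 * p - 1 \<and> b = 0) \<or> a + b = 2 * p - 1"
  proof (cases "a < p"; cases "b < p")
    assume "a < p" "b < p"
    then have "matching_colours p (colour (2 * p) k ` arc s t) \<longleftrightarrow>
      (\<exists>i\<in>{1..p - 1}. 2 * a + 2 = 2 * i \<and> 2 * b + 1 = 2 * i + 1 \<or> 2 * a + 2 = 2 * i + 1 \<and> 2 * b + 1 = 2 * i)"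
      unfolding img matching_colours_def by (simp add: doubleton_eq_iff)
    also have "\<dots> \<longleftrightarrow> b = a + 1"
      using \<open>b < p\<close> by (auto intro: bexI[of _ b]) presburger
    finally show ?thesis using \<open>a < p\<close> \<open>b < p\<close> by auto
  next
    assume "a < p" "\<not> b < p"
    then have "matching_colours p (colour (2 * p) k ` arc s t) \<longleftrightarrow>
      (\<exists>i\<in>{1..2 * p}. 2 * a + 2 = i \<and> 4 * p - 2 * b = i)"
      unfolding img matching_colours_def by (simp add: doubleton_eq_iff)
    also have "\<dots> \<longleftrightarrow> a + b = 2 * p - 1"
      using \<open>a < p\<close> ab by auto
    finally show ?thesis using \<open>a < p\<close> \<open>\<not> b < p\<close> by auto
  next
    assume "\<not> a < p" "b < p"
    then have "matching_colours p (colour (2 * p) k ` arc s t) \<longleftrightarrow>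
      (\<exists>i\<in>{1..2 * p}. 2 * b + 1 = i \<and> 4 * p - 2 * a - 1 = i)"
      unfolding img matching_colours_def by (auto simp add: doubleton_eq_iff)
    also have "\<dots> \<longleftrightarrow> a + b = 2 * p - 1"
      using \<open>b < p\<close> ab by auto
    finally show ?thesis using \<open>\<not> a < p\<close> \<open>b < p\<close> by auto
  next
    assume nab: "\<not> a < p" "\<not> b < p"
    then have "matching_colours p (colour (2 * p) k ` arc s t) \<longleftrightarrow>
      (\<exists>i\<in>{1..p - 1}. 4 * p - 2 * a - 1 = 2 * i + 1 \<and> 4 * p - 2 * b = 2 * i
         \<or> 4 * p - 2 * a - 1 = 2 * i \<and> 4 * p - 2 * b = 2 * i + 1)"
      unfolding img matching_colours_def by (simp add: doubleton_eq_iff)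
    also have "\<dots> \<longleftrightarrow> b = a + 1"
    proof
      assume "b = a + 1"
      then show "\<exists>i\<in>{1..p - 1}. 4 * p - 2 * a - 1 = 2 * i + 1 \<and> 4 * p - 2 * b = 2 * i
         \<or> 4 * p - 2 * a - 1 = 2 * i \<and> 4 * p - 2 * b = 2 * i + 1"
        using nab ab by (intro bexI[of _ "2 * p - b"]) auto
    qed (use ab in \<open>auto; presburger\<close>)
    finally show ?thesis using nab p by auto
  qed
  then show ?thesis using cong_residues[of s t p] assms p by (simp add: a_def b_def)
qed

lemma colour_adapted_iff:
  assumes P: "P \<in> NC (2 * p * k)"
  shows "colour_adapted p P \<longleftrightarrow> (\<forall>e\<in>fatten P. matching_colours p (colour (2 * p) k ` e))"
proof -
  have "matching_colours p (colour (2 * p) k ` arc s (block_succ V s)) \<longleftrightarrow>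
      [int (block_succ V s) = int s + 1] (mod (2 * int p)) \<or>
      [int (block_succ V s) = 2 * int p - int s + 1] (mod (2 * int p))"
    if V: "V \<in> P" "s \<in> V" for V s
    using NC_blockD(2)[OF P V(1)] V block_succ_bounds[OF P V]
    by (intro matching_colours_arc_iff) auto
  then have "colour_adapted p P \<longleftrightarrow>
      (\<forall>V\<in>P. \<forall>s\<in>V. matching_colours p (colour (2 * p) k ` arc s (block_succ V s)))"
    by (simp add: colour_adapted_def)
  then show ?thesis by (auto simp: fatten_def)
qed

lemma label_adapted_fatten_iff:
  assumes P: "P \<in> NC n"
    and lab: "\<And>s. s \<in> {1..n} \<Longrightarrow> lab' (2 * s) = lab s" "\<And>s. s \<in> {1..n} \<Longrightarrow> lab' (2 * s - 1) = lab s"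
  shows "label_adapted lab' (fatten P) \<longleftrightarrow> label_adapted lab P"
proof -
  have "(\<forall>x\<in>arc s (block_succ V s). \<forall>y\<in>arc s (block_succ V s). lab' x = lab' y) \<longleftrightarrow>
      lab s = lab (block_succ V s)" if V: "V \<in> P" "s \<in> V" for V s
    using NC_blockD(2)[OF P V(1)] V block_succ_bounds[OF P V] lab
    by (auto simp: arc_def)
  then have "label_adapted lab' (fatten P) \<longleftrightarrow> (\<forall>V\<in>P. \<forall>s\<in>V. lab s = lab (block_succ V s))"
    unfolding label_adapted_def fatten_def by blast
  also have "\<dots> \<longleftrightarrow> label_adapted lab P"
    unfolding label_adapted_def using constant_on_block_iff[OF NC_blockD(1,3)[OF P], of _ lab] by simp
  finally show ?thesis .
qed

theorem lemma4p1:
  fixes p k :: nat and u :: "nat \<Rightarrow> 'a"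
  shows "\<exists>f. bij_betw f (NC_W p k u) (NC2_W p k u)"
proof
  let ?n = "2 * p * k"
  let ?lab = "\<lambda>s. u (idx (colour p k s))"
  let ?lab' = "\<lambda>s. u ((idx (colour (2 * p) k s) + 1) div 2)"
  \<comment> \<open>Fattening matches the two sets of conditions, so its bijectivity restricts to the subsets.\<close>
  have mem: "fatten P \<in> NC2_W p k u \<longleftrightarrow> P \<in> NC_W p k u" if P: "P \<in> NC ?n" for P
  proof -
    have "label_adapted ?lab' (fatten P) \<longleftrightarrow> label_adapted ?lab P"
      using P by (rule label_adapted_fatten_iff) (simp_all only: atLeastAtMost_iff idx_colour_doubled)
    moreover have "fatten P \<in> NC_pair (4 * p * k)"
      using fatten_in_NC_pair[OF P] by (simp add: mult.assoc)
    ultimately show ?thesis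
      using P colour_adapted_iff[OF P]
      by (auto simp: NC_W_def NC2_W_def matching_colours_def)
  qed
  have bij: "bij_betw fatten (NC ?n) (NC_pair (4 * p * k))"
    using bij_betw_fatten[of ?n] by (simp add: mult.assoc)
  have sub: "NC_W p k u \<subseteq> NC ?n" "NC2_W p k u \<subseteq> NC_pair (4 * p * k)"
    by (auto simp: NC_W_def NC2_W_def)
  show "bij_betw fatten (NC_W p k u) (NC2_W p k u)"
  proof (rule bij_betw_subset[OF bij sub(1)])
    show "fatten ` NC_W p k u = NC2_W p k u"
    proof
      show "fatten ` NC_W p k u \<subseteq> NC2_W p k u" using mem sub(1) by blast
      show "NC2_W p k u \<subseteq> fatten ` NC_W p k u"
      proof
        fix Q assume Q: "Q \<in> NC2_W p k u"
        then obtain P where "P \<in> NC ?n" "Q = fatten P"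
          using sub(2) bij unfolding bij_betw_def by blast
        then show "Q \<in> fatten ` NC_W p k u" using mem Q by blast
      qed
    qed
  qed
qed

end
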